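(* Let $d\ge 2$, $n\ge 2$, let $G_t=(V_t,E_t)$ be a simple undirected graph with $V_t=\{1,\dots,n\}$, and let $\{\mathbf{t}_i^0\}_{i\in V_t}\subseteq\mathbb{R}^d$ be locations in generic position. For $(i,j)\in E_t$ let $\Gamma^0_{ij}=\frac{(\mathbf{t}_i^0-\mathbf{t}_j^0)(\mathbf{t}_i^0-\mathbf{t}_j^0)^T}{\|\mathbf{t}_i^0-\mathbf{t}_j^0\|_2^2}$, and assume that the (noiseless) formation $\{\Gamma^0_{ij}\}_{(i,j)\in E_t}$ is parallel rigid. Let $L^0\in\mathbb{R}^{dn\times dn}$ be the Laplacian built from $Q^0_{ij}=I_d-\Gamma^0_{ij}$. Then the semidefinite relaxation $$\min_{T\in\mathbb{R}^{dn\times dn}}\ \mathrm{Tr}(L^0T)\quad\text{subject to}\quad \mathrm{Tr}(C^{ij}T)\ge 1\ \ \forall (i,j)\in E_t,\quad \mathrm{Tr}(HT)=0,\quad T\succeq 0,$$ followed by the deterministic rounding procedure, recovers the locations exactly: for every solution (minimizer) $T^*$ of this program, the rounded solution $\{\hat{\mathbf{t}}_i\}_{i\in V_t}$ obtained from $T^*$ is congruent to $\{\mathbf{t}^0_i\}_{i\in V_t}$.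
   Context: Matrices of size $dn\times dn$ are viewed as $n\times n$ arrays of $d\times d$ blocks, and $T\succeq0$ means $T$ is symmetric positive semidefinite. Generic position: the $dn$ coordinates of $(\mathbf{t}^0_1,\dots,\mathbf{t}^0_n)$ are algebraically independent, i.e. no non-zero polynomial with integer coefficients vanishes at them. Laplacian: given symmetric matrices $Q_{ij}=Q_{ji}\in\mathbb{R}^{d\times d}$ for $(i,j)\in E_t$, the Laplacian $L$ has blocks $L_{ij}=-Q_{ij}$ for $(i,j)\in E_t$, $L_{ii}=\sum_{k:(i,k)\in E_t}Q_{ik}$, and $0$ otherwise. $L^0$ is this matrix for $Q_{ij}=Q^0_{ij}$. Constraint matrices: for $(i,j)\in E_t$, $C^{ij}\in\mathbb{R}^{dn\times dn}$ has $(i,i)$ and $(j,j)$ blocks $I_d$, $(i,j)$ and $(j,i)$ blocks $-I_d$, and all other blocks $0$. $H=J_n\otimes I_d$, where $J_n$ is the $n\times n$ all-ones matrix. Congruence: point sets $\{\mathbf{p}_i\}$, $\{\mathbf{q}_i\}$ in $\mathbb{R}^d$ are congruent if there are $c\in\mathbb{R}\setminus\{0\}$ and $\mathbf{x}\in\mathbb{R}^d$ with $\mathbf{q}_i=c\mathbf{p}_i+\mathbf{x}$ for all $i$. Parallel rigidity: for pairwise distinct points $\mathbf{p}_1,\dots,\mathbf{p}_n\in\mathbb{R}^d$, the formation with lines $\Gamma_{ij}=(\mathbf{p}_i-\mathbf{p}_j)(\mathbf{p}_i-\mathbf{p}_j)^T/\|\mathbf{p}_i-\mathbf{p}_j\|_2^2$,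 $(i,j)\in E_t$, is parallel rigid if every set of pairwise distinct points $\mathbf{q}_1,\dots,\mathbf{q}_n\in\mathbb{R}^d$ with $\mathbf{q}_i-\mathbf{q}_j$ parallel to $\mathbf{p}_i-\mathbf{p}_j$ for all $(i,j)\in E_t$ is congruent to $\{\mathbf{p}_i\}$. Equivalently, the linear system $(I_d-\Gamma_{ij})(\mathbf{q}_i-\mathbf{q}_j)=0$, $(i,j)\in E_t$, in the unknown $\mathbf{q}\in\mathbb{R}^{dn}$ has a solution space of dimension exactly $d+1$. Rounding procedure: given a solution $T^*$, let $\hat{\mathbf{t}}\in\mathbb{R}^{dn}$ be a (nonzero) leading eigenvector of $T^*$ (for its largest eigenvalue); $\hat{\mathbf{t}}_i\in\mathbb{R}^d$ is the $i$-th $d\times1$ block of $\hat{\mathbf{t}}$. *)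

theory Defs
  imports "HOL-Analysis.Analysis" "HOL-Library.Poly_Mapping"
begin

text \<open>
  Conventions.  The vertices are the elements of a finite type \<open>'n\<close>, and \<open>d = CARD('d)\<close>.  An edge
  set is a symmetric irreflexive relation on \<open>'n\<close> (each undirected edge occurs in both orientations).
  The \<open>dn\<close> coordinates are indexed by \<open>'n \<times> 'd\<close>: the pair \<open>(i, a)\<close> is the \<open>a\<close>-th coordinate of
  block \<open>i\<close>.
\<close>

definition block_matrix ::
  "('n::finite \<Rightarrow> 'n \<Rightarrow> real^('d::finite)^'d) \<Rightarrow> real^('n \<times> 'd)^('n \<times> 'd)" where
  "block_matrix B = (\<chi> r c. B (fst r) (fst c) $ snd r $ snd c)"

definition vector_block :: "real^('n::finite \<times> 'd::finite) \<Rightarrow> 'n \<Rightarrow> real^'d" where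
  "vector_block v i = (\<chi> a. v $ (i, a))"

text \<open>
  An integer polynomial in the variables \<open>'v\<close> is a finitely supported map from monomials
  (finitely supported exponent vectors) to coefficients.
\<close>

definition int_poly_eval :: "(('v \<Rightarrow>\<^sub>0 nat) \<Rightarrow>\<^sub>0 int) \<Rightarrow> ('v \<Rightarrow> real) \<Rightarrow> real" where
  "int_poly_eval P x =
     (\<Sum>m\<in>Poly_Mapping.keys P. of_int (Poly_Mapping.lookup P m) *
        (\<Prod>v\<in>Poly_Mapping.keys m. x v ^ Poly_Mapping.lookup m v))"

definition generic_position :: "('n::finite \<Rightarrow> real^('d::finite)) \<Rightarrow> bool" where
  "generic_position t \<longleftrightarrow>
     (\<forall>P :: (('n \<times> 'd) \<Rightarrow>\<^sub>0 nat) \<Rightarrow>\<^sub>0 int. P \<noteq> 0 \<longrightarrow> int_poly_eval P (\<lambda>(i, a). t i $ a) \<noteq> 0)"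

definition outer_product :: "real^'d \<Rightarrow> real^'d \<Rightarrow> real^('d::finite)^'d" where
  "outer_product u v = (\<chi> a b. u $ a * v $ b)"

definition line_projection :: "('n \<Rightarrow> real^'d) \<Rightarrow> 'n \<Rightarrow> 'n \<Rightarrow> real^('d::finite)^'d" where
  "line_projection p i j = (1 / (norm (p i - p j))\<^sup>2) *\<^sub>R outer_product (p i - p j) (p i - p j)"

definition congruent_points :: "('n \<Rightarrow> real^('d::finite)) \<Rightarrow> ('n \<Rightarrow> real^'d) \<Rightarrow> bool" where
  "congruent_points p q \<longleftrightarrow> (\<exists>c x. c \<noteq> 0 \<and> (\<forall>i. q i = c *\<^sub>R p i + x))"

text \<open>Only meaningful for nonzero vectors.\<close>

definition parallel_vectors :: "'a::real_vector \<Rightarrow> 'a \<Rightarrow> bool" where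
  "parallel_vectors u v \<longleftrightarrow> (\<exists>c. c \<noteq> 0 \<and> v = c *\<^sub>R u)"

text \<open>
  Parallel rigidity of the formation that \<open>p\<close> induces on \<open>E\<close>; only meaningful for pairwise distinct
  points \<open>p\<close> (which generic position entails).
\<close>

definition parallel_rigid :: "('n \<times> 'n) set \<Rightarrow> ('n \<Rightarrow> real^('d::finite)) \<Rightarrow> bool" where
  "parallel_rigid E p \<longleftrightarrow>
     (\<forall>q. inj q \<and> (\<forall>(i, j)\<in>E. parallel_vectors (p i - p j) (q i - q j)) \<longrightarrow> congruent_points p q)"

definition laplacian ::
  "('n::finite \<times> 'n) set \<Rightarrow> ('n \<Rightarrow> 'n \<Rightarrow> real^('d::finite)^'d) \<Rightarrow> real^('n \<times> 'd)^('n \<times> 'd)" where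
  "laplacian E Q = block_matrix (\<lambda>i j.
     if i = j then (\<Sum>k | (i, k) \<in> E. Q i k)
     else if (i, j) \<in> E then - Q i j
     else 0)"

definition edge_constraint_matrix ::
  "'n::finite \<Rightarrow> 'n \<Rightarrow> real^('n \<times> 'd::finite)^('n \<times> 'd)" where
  "edge_constraint_matrix i j = block_matrix (\<lambda>k l.
     if k = l \<and> (k = i \<or> k = j) then mat 1
     else if (k = i \<and> l = j) \<or> (k = j \<and> l = i) then - mat 1
     else 0)"

definition kronecker ::
  "real^('n::finite)^'n \<Rightarrow> real^('d::finite)^'d \<Rightarrow> real^('n \<times> 'd)^('n \<times> 'd)" where
  "kronecker A B = block_matrix (\<lambda>i j. (A $ i $ j) *\<^sub>R B)"

definition centering_matrix :: "real^('n::finite \<times> 'd::finite)^('n \<times> 'd)" where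
  "centering_matrix = kronecker (\<chi> i j. 1) (mat 1)"

definition pos_semidef :: "real^('k::finite)^'k \<Rightarrow> bool" where
  "pos_semidef T \<longleftrightarrow> transpose T = T \<and> (\<forall>x. 0 \<le> x \<bullet> (T *v x))"

definition sdp_feasible ::
  "('n::finite \<times> 'n) set \<Rightarrow> real^('n \<times> 'd::finite)^('n \<times> 'd) \<Rightarrow> bool" where
  "sdp_feasible E T \<longleftrightarrow>
     (\<forall>(i, j)\<in>E. trace (edge_constraint_matrix i j ** T) \<ge> 1) \<and>
     trace (centering_matrix ** T) = 0 \<and>
     pos_semidef T"

definition sdp_solution ::
  "('n::finite \<times> 'n) set \<Rightarrow> real^('n \<times> 'd::finite)^('n \<times> 'd) \<Rightarrow> real^('n \<times> 'd)^('n \<times> 'd) \<Rightarrow> bool" where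
  "sdp_solution E L T \<longleftrightarrow> is_arg_min (\<lambda>T. trace (L ** T)) (sdp_feasible E) T"

definition eigenvector_for :: "real^('k::finite)^'k \<Rightarrow> real^'k \<Rightarrow> real \<Rightarrow> bool" where
  "eigenvector_for A v l \<longleftrightarrow> v \<noteq> 0 \<and> A *v v = l *\<^sub>R v"

definition leading_eigenvector :: "real^('k::finite)^'k \<Rightarrow> real^'k \<Rightarrow> bool" where
  "leading_eigenvector A v \<longleftrightarrow>
     (\<exists>l. eigenvector_for A v l \<and> (\<forall>w m. eigenvector_for A w m \<longrightarrow> m \<le> l))"

end

theory Submission
  imports Defs
begin

text \<open>
  All matrices of the program are sums of Gram matrices \<open>A A\<^sup>T\<close>, and for \<open>T \<succeq> 0\<close> the trace of
  \<open>A A\<^sup>T T\<close> is nonnegative and vanishes only if \<open>A\<^sup>T T = 0\<close>. A large multiple of \<open>v v\<^sup>T\<close>, with \<open>v\<close> the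
  centred locations, is feasible with objective value \<open>0\<close>. Hence the columns of every minimizer lie
  in the kernel of the Laplacian and are centred; by rigidity they are multiples of \<open>v\<close>. The edge
  constraints make the minimizer nonzero, so its leading eigenvectors are multiples of \<open>v\<close> too.
\<close>

text \<open>As a simp rule this would turn \<open>transpose A *v x\<close> into
  \<open>x v* A\<close>, whereas the lemmas below keep the first form.\<close>

declare transpose_matrix_vector [simp del]

section \<open>Generic position and distinctness of the points\<close>

text \<open>If two points shared a coordinate, this polynomial would witness an algebraic
  dependence.\<close>

lemma int_poly_eval_variable_difference:
  assumes "v \<noteq> w"
  defines "P \<equiv> Poly_Mapping.single (Poly_Mapping.single v 1) 1
             - Poly_Mapping.single (Poly_Mapping.single w 1) (1::int)"
  shows "P \<noteq> 0" and "int_poly_eval P x = x v - x w"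
proof -
  let ?mv = "Poly_Mapping.single v (1::nat)" and ?mw = "Poly_Mapping.single w (1::nat)"
  have ne: "?mv \<noteq> ?mw"
    using assms by (metis lookup_single_eq lookup_single_not_eq zero_neq_one)
  have lookup: "Poly_Mapping.lookup P m = (if m = ?mv then 1 else if m = ?mw then - 1 else 0)" for m
    using ne by (auto simp: P_def lookup_minus lookup_single when_def)
  then have keys: "Poly_Mapping.keys P = {?mv, ?mw}"
    by (auto simp: in_keys_iff split: if_splits)
  then show "P \<noteq> 0" by auto
  show "int_poly_eval P x = x v - x w"
    using ne by (simp add: int_poly_eval_def keys lookup)
qed

lemma generic_position_inj:
  fixes t :: "'n::finite \<Rightarrow> real^('d::finite)"
  assumes "generic_position t"
  shows "inj t"
proof (rule injI, rule ccontr)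
  fix i j assume eq: "t i = t j" and "i \<noteq> j"
  \<comment> \<open>Equal points agree in every coordinate, so an arbitrary one is picked.\<close>
  obtain a :: 'd where True by blast
  have "(i, a) \<noteq> (j, a)" using \<open>i \<noteq> j\<close> by simp
  note P = int_poly_eval_variable_difference[OF this]
  from assms P(1) have "(\<lambda>(i, a). t i $ a) (i, a) - (\<lambda>(i, a). t i $ a) (j, a) \<noteq> 0"
    unfolding generic_position_def P(2)[symmetric] by blast
  with eq show False by simp
qed

section \<open>Quadratic forms and traces against Gram matrices\<close>

lemma symmetric_matrix_inner:
  fixes T :: "real^('k::finite)^'k"
  assumes "transpose T = T"
  shows "x \<bullet> (T *v y) = y \<bullet> (T *v x)"
  by (metis assms dot_lmul_matrix inner_commute transpose_matrix_vector)

text \<open>Otherwise a short step from \<open>x\<close> in direction \<open>- (T *v x)\<close>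
  makes the form negative: the linear term has nonzero slope and beats the quadratic one.\<close>

lemma pos_semidef_null_vector:
  fixes T :: "real^('k::finite)^'k"
  assumes T: "pos_semidef T" and null: "x \<bullet> (T *v x) = 0"
  shows "T *v x = 0"
proof (rule ccontr)
  assume ne: "T *v x \<noteq> 0"
  let ?y = "T *v x"
  let ?b = "?y \<bullet> ?y" and ?q = "?y \<bullet> (T *v ?y)"
  have symT: "transpose T = T" and nonneg: "\<And>x. 0 \<le> x \<bullet> (T *v x)"
    using T by (auto simp: pos_semidef_def)
  have b: "?b > 0" using ne by simp
  have q: "?q \<ge> 0" using nonneg .
  have xy: "x \<bullet> (T *v ?y) = ?b"
    using symmetric_matrix_inner[OF symT, of x ?y] by simp
  \<comment> \<open>Adding 1 keeps the denominator positive even if \<open>?q\<close> is 0, and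
    still gives \<open>e * ?q \<le> ?b\<close>.\<close>
  define e where "e = ?b / (?q + 1)"
  have e: "e > 0" using b q by (simp add: e_def)
  have "e * ?q < 2 * ?b"
  proof -
    have "e * ?q \<le> e * (?q + 1)" using e by simp
    also have "\<dots> = ?b" using q by (simp add: e_def)
    finally show ?thesis using b by linarith
  qed
  then have "e * (e * ?q - 2 * ?b) < 0" using e by (simp add: mult_pos_neg)
  moreover have "(x - e *\<^sub>R ?y) \<bullet> (T *v (x - e *\<^sub>R ?y)) = e * (e * ?q - 2 * ?b)"
    by (simp add: matrix_vector_mult_diff_distrib matrix_vector_mult_scaleR inner_diff_left
        inner_diff_right xy null algebra_simps)
  ultimately show False using nonneg[of "x - e *\<^sub>R ?y"] by simp
qed

text \<open>By cyclicity this is the trace of \<open>transpose A ** T ** A\<close>, whose diagonal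
  holds the form of \<open>T\<close> at the columns of \<open>A\<close>.\<close>

lemma trace_gram_mult:
  fixes A :: "real^('m::finite)^('k::finite)"
  shows "trace (A ** transpose A ** T) = (\<Sum>a\<in>UNIV. column a A \<bullet> (T *v column a A))"
proof -
  have "trace (A ** transpose A ** T) = trace (transpose A ** T ** A)"
    by (metis matrix_mul_assoc trace_mul_sym)
  also have "\<dots> = trace (transpose A ** (T ** A))"
    by (simp add: matrix_mul_assoc)
  also have "\<dots> = (\<Sum>a\<in>UNIV. column a A \<bullet> (T *v column a A))"
    by (simp add: trace_def matrix_matrix_mult_def matrix_vector_mult_def inner_vec_def
        transpose_def column_def)
  finally show ?thesis .
qed

lemma trace_gram_nonneg:
  assumes "pos_semidef T"
  shows "0 \<le> trace (A ** transpose A ** T)"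
  using assms by (simp add: trace_gram_mult pos_semidef_def sum_nonneg)

text \<open>A vanishing sum of nonnegative terms puts every column of \<open>A\<close> in the kernel
  of \<open>T\<close>; symmetry of \<open>T\<close> moves this to the other side.\<close>

lemma trace_gram_eq_0:
  fixes A :: "real^('m::finite)^('k::finite)"
  assumes T: "pos_semidef T" and "trace (A ** transpose A ** T) = 0"
  shows "transpose A *v (T *v x) = 0"
proof -
  have "column a A \<bullet> (T *v column a A) = 0" for a
  proof -
    have "(\<Sum>a\<in>UNIV. column a A \<bullet> (T *v column a A)) = 0"
      using assms by (simp add: trace_gram_mult)
    then show ?thesis
      using T by (subst (asm) sum_nonneg_eq_0_iff) (auto simp: pos_semidef_def)
  qed
  then have null: "T *v column a A = 0" for a
    using T by (rule pos_semidef_null_vector[rotated])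
  have "(transpose A *v (T *v x)) $ a = column a A \<bullet> (T *v x)" for a
    by (subst matrix_vector_mult_def) (simp add: inner_vec_def transpose_def column_def)
  also have "\<dots> a = x \<bullet> (T *v column a A)" for a
    using T by (intro symmetric_matrix_inner) (simp add: pos_semidef_def)
  finally show ?thesis by (simp add: vec_eq_iff null)
qed

lemma outer_product_mult_vector: "outer_product u v *v x = (v \<bullet> x) *\<^sub>R u"
  by (simp add: vec_eq_iff outer_product_def matrix_vector_mult_def inner_vec_def
      sum_distrib_left mult_ac)

lemma transpose_outer_product: "transpose (outer_product u u) = outer_product u u"
  by (simp add: vec_eq_iff outer_product_def transpose_def mult.commute)

text \<open>Evaluates objective and constraints at a rank-one candidate.\<close>

lemma trace_gram_outer_product:
  fixes A :: "real^('m::finite)^('k::finite)"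
  shows "trace (A ** transpose A ** outer_product v v) = (norm (transpose A *v v))\<^sup>2"
proof -
  have "column a A \<bullet> v = (transpose A *v v) $ a" for a
    by (simp add: matrix_vector_mult_def inner_vec_def transpose_def column_def)
  then show ?thesis
    by (simp add: trace_gram_mult outer_product_mult_vector inner_commute
        power2_norm_eq_inner inner_vec_def[of "transpose A *v v"])
qed

lemma matrix_mult_sum_left:
  fixes f :: "'i \<Rightarrow> real^('m::finite)^('k::finite)"
  shows "sum f I ** T = (\<Sum>i\<in>I. f i ** T)"
  by (induction I rule: infinite_finite_induct)
    (simp_all add: matrix_matrix_mult_def vec_eq_iff sum.distrib ring_distribs)

lemma trace_sum:
  fixes f :: "'i \<Rightarrow> real^('k::finite)^'k"
  shows "trace (sum f I) = (\<Sum>i\<in>I. trace (f i))"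
  by (induction I rule: infinite_finite_induct) (simp_all add: trace_add trace_0[unfolded mat_0])

lemma trace_scaleR: "trace (c *\<^sub>R A) = c * trace (A :: real^('k::finite)^'k)"
  by (simp add: trace_def sum_distrib_left)

section \<open>The matrices of the program in factored form\<close>

text \<open>The Kronecker product of the vector \<open>s\<close> with the identity matrix.\<close>

definition block_column :: "('n::finite \<Rightarrow> real) \<Rightarrow> real^('d::finite)^('n \<times> 'd)" where
  "block_column s = (\<chi> r c. s (fst r) * mat 1 $ snd r $ c)"

text \<open>This is the identity (s \<otimes> I) Q (s \<otimes> I)^T = (s s^T) \<otimes> Q. Constant
  \<open>s\<close> gives the centering matrix, and a signed edge vector gives the edge matrices and
  the terms of the Laplacian.\<close>

lemma block_column_sandwich:
  "block_column s ** Q ** transpose (block_column s) = block_matrix (\<lambda>k l. (s k * s l) *\<^sub>R Q)"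
  by (simp add: vec_eq_iff block_column_def block_matrix_def matrix_matrix_mult_def transpose_def
      mat_def if_distrib[where f = "\<lambda>x. x * _"] if_distrib[where f = "\<lambda>x. _ * x"] sum.delta sum.delta'
      cong: if_cong)

lemma transpose_block_column_mult:
  "transpose (block_column s) *v y = (\<Sum>k\<in>UNIV. s k *\<^sub>R vector_block y k)"
  by (simp add: vec_eq_iff block_column_def vector_block_def matrix_vector_mult_def transpose_def
      mat_def if_distrib[where f = "\<lambda>x. x * _"] if_distrib[where f = "\<lambda>x. _ * x"] sum.delta sum.delta'
      sum.cartesian_product' UNIV_Times_UNIV[symmetric]
      cong: if_cong del: UNIV_Times_UNIV)

text \<open>The oriented incidence vector e_i - e_j; it vanishes for a loop.\<close>

definition edge_sign :: "'n \<Rightarrow> 'n \<Rightarrow> 'n \<Rightarrow> real" where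
  "edge_sign i j k = of_bool (k = i) - of_bool (k = j)"

lemma transpose_edge_column_mult:
  "transpose (block_column (edge_sign i j)) *v y = vector_block y i - vector_block y j"
  by (simp add: transpose_block_column_mult edge_sign_def algebra_simps sum_subtractf
      of_bool_def if_distrib[where f = "\<lambda>x. x *\<^sub>R _"] sum.delta sum.delta' cong: if_cong)

lemma centering_matrix_gram:
  "(centering_matrix :: real^('n::finite \<times> 'd::finite)^('n \<times> 'd))
     = block_column (\<lambda>_. 1) ** transpose (block_column (\<lambda>_. 1))"
  using block_column_sandwich[of "\<lambda>_::'n. 1" "mat 1 :: real^'d^'d"]
  by (simp add: centering_matrix_def kronecker_def)

text \<open>For a loop the factor on the right is 0, while the left side keeps an identity block;
  hence the hypothesis.\<close>

lemma edge_constraint_matrix_gram: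
  assumes "i \<noteq> j"
  shows "(edge_constraint_matrix i j :: real^('n::finite \<times> 'd::finite)^('n \<times> 'd))
     = block_column (edge_sign i j) ** transpose (block_column (edge_sign i j))"
proof -
  have "(edge_constraint_matrix i j :: real^('n \<times> 'd)^('n \<times> 'd))
     = block_matrix (\<lambda>k l. (edge_sign i j k * edge_sign i j l) *\<^sub>R mat 1)"
    using assms unfolding edge_constraint_matrix_def
    by (intro arg_cong[where f = block_matrix] ext) (auto simp: edge_sign_def)
  then show ?thesis
    using block_column_sandwich[of "edge_sign i j" "mat 1 :: real^'d^'d"] by simp
qed

text \<open>The factor 1/2 compensates for each undirected edge occurring in \<open>E\<close> in
  both orientations, with equal contributions.\<close>

lemma laplacian_eq_sum:
  fixes Q :: "'n::finite \<Rightarrow> 'n \<Rightarrow> real^('d::finite)^'d"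
  assumes "sym E" "irrefl E" and Q: "\<And>i j. Q i j = Q j i"
  shows "laplacian E Q = (1/2) *\<^sub>R (\<Sum>(i, j)\<in>E. block_column (edge_sign i j) ** Q i j
           ** transpose (block_column (edge_sign i j)))"
proof -
  have swap: "(\<Sum>(i, j)\<in>E. g i j) = (\<Sum>(i, j)\<in>E. g j i)" for g :: "'n \<Rightarrow> 'n \<Rightarrow> real"
    using \<open>sym E\<close> by (intro sum.reindex_bij_witness[where i = prod.swap and j = prod.swap])
      (auto dest: symD)
  have *: "(\<Sum>(i, j)\<in>E. edge_sign i j k * edge_sign i j l * Q i j $ a $ b)
      = 2 * (if k = l then (\<Sum>m | (k, m) \<in> E. Q k m) else if (k, l) \<in> E then - Q k l else 0) $ a $ b"
    for k l a b
  proof -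
    let ?q = "\<lambda>i j. Q i j $ a $ b"
    \<comment> \<open>Edges leaving \<open>k\<close> are indexed by their other endpoint;
      \<open>swap\<close> reduces edges entering \<open>k\<close> to this case.\<close>
    have row: "(\<Sum>(i, j)\<in>E. of_bool (k = i \<and> P j) * ?q i j)
      = (\<Sum>m | (k, m) \<in> E \<and> P m. ?q k m)" for P
    proof -
      have "(\<Sum>(i, j)\<in>E. of_bool (k = i \<and> P j) * ?q i j)
          = (\<Sum>(i, j)\<in>Pair k ` {m. (k, m) \<in> E \<and> P m}. ?q i j)"
        by (rule sum.mono_neutral_cong_right) auto
      also have "\<dots> = (\<Sum>m | (k, m) \<in> E \<and> P m. ?q k m)"
        by (subst sum.reindex) (auto simp: inj_on_def)
      finally show ?thesis .
    qed
    show ?thesis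
    proof (cases "k = l")
      case True
      have "(\<Sum>(i, j)\<in>E. edge_sign i j k * edge_sign i j l * ?q i j)
          = (\<Sum>(i, j)\<in>E. of_bool (k = i) * ?q i j + of_bool (k = j) * ?q j i)"
        using \<open>irrefl E\<close> True Q by (intro sum.cong) (auto simp: edge_sign_def irrefl_def)
      also have "\<dots> = (\<Sum>(i, j)\<in>E. of_bool (k = i) * ?q i j) + (\<Sum>(i, j)\<in>E. of_bool (k = j) * ?q j i)"
        by (simp add: sum.distrib case_prod_beta)
      also have "\<dots> = 2 * (\<Sum>m | (k, m) \<in> E. ?q k m)"
        using row[of "\<lambda>_. True"] swap[of "\<lambda>i j. of_bool (k = i) * ?q i j"] by simp
      finally show ?thesis using True by simp
    next
      case False
      \<comment> \<open>Both signs are nonzero only on the edge between \<open>k\<close> and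
        \<open>l\<close>, where their product is -1.\<close>
      have "(\<Sum>(i, j)\<in>E. edge_sign i j k * edge_sign i j l * ?q i j)
          = (\<Sum>(i, j)\<in>E. - (of_bool (k = i \<and> j = l) * ?q i j) - of_bool (k = j \<and> i = l) * ?q j i)"
        using \<open>irrefl E\<close> False Q by (intro sum.cong) (auto simp: edge_sign_def irrefl_def)
      also have "\<dots> = - (\<Sum>(i, j)\<in>E. of_bool (k = i \<and> j = l) * ?q i j)
          - (\<Sum>(i, j)\<in>E. of_bool (k = j \<and> i = l) * ?q j i)"
        by (simp add: sum_subtractf sum_negf case_prod_beta)
      also have "\<dots> = - 2 * (\<Sum>m | (k, m) \<in> E \<and> m = l. ?q k m)"
        using row[of "\<lambda>j. j = l"] swap[of "\<lambda>i j. of_bool (k = i \<and> j = l) * ?q i j"] by simp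
      also have "{m. (k, m) \<in> E \<and> m = l} = (if (k, l) \<in> E then {l} else {})" by auto
      finally show ?thesis using False by simp
    qed
  qed
  show ?thesis
    by (simp add: vec_eq_iff laplacian_def block_column_sandwich block_matrix_def case_prod_beta
        *[unfolded case_prod_beta])
qed

section \<open>Complementary projections and the noiseless Laplacian\<close>

lemma line_projection_mult:
  "line_projection p i j *v x = (((p i - p j) \<bullet> x) / (norm (p i - p j))\<^sup>2) *\<^sub>R (p i - p j)"
  by (simp add: line_projection_def outer_product_mult_vector scaleR_matrix_vector_assoc[symmetric])

lemma line_projection_commute: "line_projection p i j = line_projection p j i"
  by (simp add: line_projection_def outer_product_def norm_minus_commute vec_eq_iff algebra_simps)

lemma transpose_complement_projection:
  "transpose (mat 1 - line_projection p i j) = mat 1 - line_projection p i j"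
  by (simp add: line_projection_def vec_eq_iff transpose_def mat_def outer_product_def
      mult.commute eq_commute)

text \<open>The matrix is symmetric and idempotent, being an orthogonal projection.\<close>

lemma complement_projection_gram:
  fixes p :: "'n \<Rightarrow> real^('d::finite)"
  defines "P \<equiv> \<lambda>i j. mat 1 - line_projection p i j"
  shows "P i j = P i j ** transpose (P i j)"
proof -
  have "transpose (P i j) = P i j"
    by (simp add: P_def transpose_complement_projection)
  moreover have "P i j *v (P i j *v x) = P i j *v x" for x
    \<comment> \<open>For coinciding points the line projection is 0, so \<open>P i j\<close> is the
      identity.\<close>
    by (cases "p i = p j")
      (simp_all add: P_def matrix_vector_mult_diff_rdistrib line_projection_mult
        inner_diff_right power2_norm_eq_inner[symmetric])
  ultimately show ?thesis
    by (simp add: matrix_eq matrix_vector_mul_assoc[symmetric])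
qed

text \<open>Absorbing the projection into the block column makes each edge term a Gram matrix, so
  the objective is a sum of terms that are nonnegative on the feasible set.\<close>

lemma trace_laplacian_projection:
  fixes p :: "'n::finite \<Rightarrow> real^('d::finite)"
  defines "P \<equiv> \<lambda>i j. mat 1 - line_projection p i j"
  defines "A \<equiv> \<lambda>i j. block_column (edge_sign i j) ** P i j"
  assumes "sym E" "irrefl E"
  shows "trace (laplacian E P ** T) = (1/2) * (\<Sum>(i, j)\<in>E. trace (A i j ** transpose (A i j) ** T))"
proof -
  have "A i j ** transpose (A i j)
      = block_column (edge_sign i j) ** P i j ** transpose (block_column (edge_sign i j))" for i j
    using complement_projection_gram[of p i j]
    by (simp add: A_def P_def matrix_transpose_mul matrix_mul_assoc)
      (metis matrix_mul_assoc)
  moreover have "P i j = P j i" for i j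
    by (simp add: P_def line_projection_commute)
  ultimately show ?thesis
    using assms by (simp add: laplacian_eq_sum scalar_matrix_assoc[symmetric] trace_scaleR
        matrix_mult_sum_left trace_sum case_prod_beta)
qed

lemma transpose_projected_edge_column_mult:
  fixes p :: "'n::finite \<Rightarrow> real^('d::finite)"
  shows "transpose (block_column (edge_sign i j) ** (mat 1 - line_projection p i j)) *v y
    = (let z = vector_block y i - vector_block y j in z - line_projection p i j *v z)"
  by (simp add: transpose_complement_projection matrix_transpose_mul
      matrix_vector_mul_assoc[symmetric] transpose_edge_column_mult
      matrix_vector_mult_diff_rdistrib Let_def)

section \<open>Consequences of parallel rigidity\<close>

text \<open>
  Rigidity is a statement about nondegenerate formations; it controls a degenerate \<open>q\<close> as well,
  because \<open>p + \<epsilon> q\<close> is nondegenerate for small \<open>\<epsilon>\<close>.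
\<close>

lemma parallel_rigid_kernel:
  fixes p q :: "'n::finite \<Rightarrow> real^('d::finite)"
  assumes rigid: "parallel_rigid E p" and "inj p"
    and parallel: "\<And>i j. (i, j) \<in> E \<Longrightarrow> \<exists>c. q i - q j = c *\<^sub>R (p i - p j)"
  shows "\<exists>c x. \<forall>i. q i = c *\<^sub>R p i + x"
proof -
  have "\<exists>\<epsilon>>0. inj (\<lambda>i. p i + \<epsilon> *\<^sub>R q i)"
  proof -
    \<comment> \<open>Only finitely many pairs have to stay apart, and each does so near \<epsilon>
      = 0 by continuity.\<close>
    have "eventually (\<lambda>\<epsilon>. \<forall>i j. i \<noteq> j \<longrightarrow> p i + \<epsilon> *\<^sub>R q i - (p j + \<epsilon> *\<^sub>R q j) \<noteq> 0) (at_right (0::real))"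
    proof (intro eventually_all_finite)
      fix i j
      show "eventually (\<lambda>\<epsilon>. i \<noteq> j \<longrightarrow> p i + \<epsilon> *\<^sub>R q i - (p j + \<epsilon> *\<^sub>R q j) \<noteq> 0) (at_right (0::real))"
      proof (cases "i = j")
        case False
        have "((\<lambda>\<epsilon>. p i + \<epsilon> *\<^sub>R q i - (p j + \<epsilon> *\<^sub>R q j)) 
            \<longlongrightarrow> p i + 0 *\<^sub>R q i - (p j + 0 *\<^sub>R q j)) (at_right (0::real))"
          by (intro tendsto_intros)
        moreover have "p i + 0 *\<^sub>R q i - (p j + 0 *\<^sub>R q j) \<noteq> 0"
          using False \<open>inj p\<close> by (simp add: inj_eq)
        ultimately show ?thesis
          using tendsto_imp_eventually_ne by (force elim: eventually_mono)
      qed simp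
    qed
    moreover have "eventually (\<lambda>\<epsilon>::real. \<epsilon> > 0) (at_right 0)"
      by (rule eventually_at_right_less)
    ultimately have "eventually (\<lambda>\<epsilon>. \<epsilon> > 0 \<and> inj (\<lambda>i. p i + \<epsilon> *\<^sub>R q i)) (at_right (0::real))"
      by eventually_elim (auto simp: inj_on_def)
    then show ?thesis
      using eventually_happens trivial_limit_at_right_real by blast
  qed
  then obtain \<epsilon> where \<epsilon>: "\<epsilon> > 0" and inj: "inj (\<lambda>i. p i + \<epsilon> *\<^sub>R q i)" by blast
  let ?r = "\<lambda>i. p i + \<epsilon> *\<^sub>R q i"
  have "parallel_vectors (p i - p j) (?r i - ?r j)" if "(i, j) \<in> E" for i j
  proof (cases "i = j")
    case True
    then show ?thesis by (auto simp: parallel_vectors_def intro: exI[of _ 1])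
  next
    case False
    from parallel[OF that] obtain c where c: "q i - q j = c *\<^sub>R (p i - p j)" by blast
    have "?r i - ?r j = (p i - p j) + \<epsilon> *\<^sub>R (q i - q j)" by (simp add: algebra_simps)
    then have eq: "?r i - ?r j = (1 + \<epsilon> * c) *\<^sub>R (p i - p j)" by (simp add: c algebra_simps)
    moreover have "?r i - ?r j \<noteq> 0" using False inj_eq[OF inj, of i j] by simp
    \<comment> \<open>\<open>parallel_vectors\<close> demands a nonzero factor; distinctness of the
      perturbed points supplies it.\<close>
    ultimately have "1 + \<epsilon> * c \<noteq> 0" by auto
    with eq show ?thesis unfolding parallel_vectors_def by blast
  qed
  with rigid inj have "congruent_points p ?r" by (auto simp: parallel_rigid_def)
  then obtain c x where cx: "\<And>i. p i + \<epsilon> *\<^sub>R q i = c *\<^sub>R p i + x"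
    by (auto simp: congruent_points_def)
  have "q i = ((c - 1) / \<epsilon>) *\<^sub>R p i + (1 / \<epsilon>) *\<^sub>R x" for i
  proof -
    have "\<epsilon> *\<^sub>R q i = (c - 1) *\<^sub>R p i + x" using cx[of i] by (simp add: algebra_simps)
    then have "(1 / \<epsilon>) *\<^sub>R \<epsilon> *\<^sub>R q i = (1 / \<epsilon>) *\<^sub>R ((c - 1) *\<^sub>R p i + x)" by simp
    then show ?thesis using \<epsilon> by (simp add: scaleR_add_right)
  qed
  then show ?thesis by blast
qed

text \<open>Without edges one point could move freely, also off a given line since the dimension is
  at least 2. An edge is what later forces the minimizer to be nonzero.\<close>

lemma parallel_rigid_nonempty:
  fixes p :: "'n::finite \<Rightarrow> real^('d::finite)"
  assumes "parallel_rigid E p" "inj p" "CARD('d) \<ge> 2" "CARD('n) \<ge> 2"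
  shows "E \<noteq> {}"
proof
  assume E: "E = {}"
  obtain i j :: 'n where "i \<noteq> j"
    using \<open>CARD('n) \<ge> 2\<close> by (metis UNIV_I card_2_iff' ex_card subset_UNIV)
  obtain z where z: "z \<notin> span {p i - p j}"
  proof -
    have "dim (span {p i - p j}) \<le> card {p i - p j}" by (simp add: dim_le_card)
    then have "dim (span {p i - p j}) < DIM(real^'d)" using \<open>CARD('d) \<ge> 2\<close> by simp
    then have "span {p i - p j} \<noteq> UNIV" by (metis dim_UNIV less_irrefl)
    then show ?thesis using that by blast
  qed
  \<comment> \<open>All points sit at 0 except \<open>i\<close>, placed at \<open>z\<close>;
    congruence would force \<open>z\<close> onto the excluded line.\<close>
  obtain c x where "\<And>k. (if k = i then z else 0) = c *\<^sub>R p k + x"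
    using parallel_rigid_kernel[OF assms(1,2), of "\<lambda>k. if k = i then z else 0"] E by auto
  from this[of i] this[of j] \<open>i \<noteq> j\<close> have "z = c *\<^sub>R p i + x" "0 = c *\<^sub>R p j + x" by auto
  then have "z = c *\<^sub>R (p i - p j)" by (simp add: algebra_simps add_eq_0_iff2)
  then show False using z by (auto simp: span_singleton)
qed

text \<open>Eigenvectors for nonzero eigenvalues lie in the range, here the line of
  \<open>v\<close>. Since \<open>v\<close> has a positive eigenvalue, so does the leading
  eigenvector.\<close>

lemma leading_eigenvector_in_line:
  fixes T :: "real^('k::finite)^'k"
  assumes T: "pos_semidef T" "T \<noteq> 0" and range: "\<And>x. T *v x \<in> span {v}"
    and lead: "leading_eigenvector T w"
  shows "\<exists>c. c \<noteq> 0 \<and> w = c *\<^sub>R v"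
proof -
  have line: "\<exists>c. T *v x = c *\<^sub>R v" for x
    using range[of x] by (auto simp: span_singleton)
  obtain x where x: "T *v x \<noteq> 0" using \<open>T \<noteq> 0\<close> by (metis matrix_eq matrix_vector_mult_0)
  obtain a where a: "T *v x = a *\<^sub>R v" using line by blast
  obtain m where m: "T *v v = m *\<^sub>R v" using line by blast
  have "a \<noteq> 0" "v \<noteq> 0" using x a by auto
  \<comment> \<open>The right side is \<open>a * (v \<bullet> v)\<close>, which is nonzero, so
    \<open>T\<close> cannot annihilate \<open>v\<close>.\<close>
  have "x \<bullet> (T *v v) = v \<bullet> (T *v x)"
    using T by (intro symmetric_matrix_inner) (simp add: pos_semidef_def)
  then have "m \<noteq> 0" using \<open>a \<noteq> 0\<close> \<open>v \<noteq> 0\<close> by (auto simp: a m)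
  moreover have "0 \<le> m * (v \<bullet> v)"
    using T(1) m by (metis inner_scaleR_right pos_semidef_def)
  ultimately have "m > 0"
    using \<open>v \<noteq> 0\<close> inner_gt_zero_iff[of v]
    by (metis less_eq_real_def mult_neg_pos not_le linorder_cases)
  obtain l where l: "w \<noteq> 0" "T *v w = l *\<^sub>R w" "m \<le> l"
    using lead m \<open>v \<noteq> 0\<close> by (auto simp: leading_eigenvector_def eigenvector_for_def)
  obtain b where b: "T *v w = b *\<^sub>R v" using line by blast
  have "l > 0" using l \<open>m > 0\<close> by simp
  then have "w = (1 / l) *\<^sub>R (l *\<^sub>R w)" by simp
  also have "\<dots> = (b / l) *\<^sub>R v" using l b by (metis scaleR_scaleR times_divide_eq_left mult_1)
  finally have "w = (b / l) *\<^sub>R v" .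
  then show ?thesis using \<open>w \<noteq> 0\<close> by (metis scaleR_zero_left)
qed

section \<open>Exact recovery by the relaxation and rounding\<close>

theorem proposition2p2:
  fixes E :: "('n::finite \<times> 'n) set"
    and t0 :: "'n \<Rightarrow> real^('d::finite)"
    and L0 T :: "real^('n \<times> 'd)^('n \<times> 'd)"
    and t_hat :: "real^('n \<times> 'd)"
  assumes "CARD('d) \<ge> 2" and "CARD('n) \<ge> 2"
    and "sym E" and "irrefl E"
    and "generic_position t0"
    and "parallel_rigid E t0"
    and "L0 = laplacian E (\<lambda>i j. mat 1 - line_projection t0 i j)"
    and "sdp_solution E L0 T"
    and "leading_eigenvector T t_hat"
  shows "congruent_points t0 (vector_block t_hat)"
proof -
  have inj: "inj t0" using assms(5) by (rule generic_position_inj)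
  have edge: "i \<noteq> j" if "(i, j) \<in> E" for i j using that \<open>irrefl E\<close> by (auto simp: irrefl_def)
  define A where "A i j = block_column (edge_sign i j) ** (mat 1 - line_projection t0 i j)" for i j
  have trL: "trace (L0 ** S) = (1/2) * (\<Sum>(i, j)\<in>E. trace (A i j ** transpose (A i j) ** S))" for S
    unfolding A_def assms(7) by (rule trace_laplacian_projection) fact+
  \<comment> \<open>Subtracting the centroid makes the blocks of \<open>v\<close> sum to 0, as the
    centering constraint demands.\<close>
  define \<mu> where "\<mu> = (1 / real CARD('n)) *\<^sub>R (\<Sum>k\<in>UNIV. t0 k)"
  define v :: "real^('n \<times> 'd)" where "v = (\<chi> r. (t0 (fst r) - \<mu>) $ snd r)"
  have v: "vector_block v k = t0 k - \<mu>" for k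
    by (simp add: v_def vector_block_def vec_eq_iff)
  have feasible: "sdp_feasible E T" using assms(8) by (simp add: sdp_solution_def is_arg_min_def)
  then have psd: "pos_semidef T" by (simp add: sdp_feasible_def)

  \<comment> \<open>The sum dominates each reciprocal squared edge length, so scaling by
    \<open>c\<close> meets all edge constraints at once.\<close>
  define c where "c = (\<Sum>(i, j)\<in>E. 1 / (norm (t0 i - t0 j))\<^sup>2)"
  have c_nonneg: "0 \<le> c" by (auto simp: c_def intro!: sum_nonneg)
  define T0 where "T0 = c *\<^sub>R outer_product v v"
  have trT0: "trace (B ** transpose B ** T0) = c * (norm (transpose B *v v))\<^sup>2"
    for B :: "real^'d^('n \<times> 'd)"
    by (simp add: T0_def matrix_scalar_ac scalar_matrix_assoc[symmetric] trace_scaleR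
        trace_gram_outer_product)
  have "sdp_feasible E T0"
    unfolding sdp_feasible_def
  proof (intro conjI)
    show "\<forall>(i, j)\<in>E. 1 \<le> trace (edge_constraint_matrix i j ** T0)"
    proof safe
      fix i j assume ij: "(i, j) \<in> E"
      then have "t0 i - t0 j \<noteq> 0" using edge inj by (auto dest: injD)
      then have n: "(norm (t0 i - t0 j))\<^sup>2 > 0" by simp
      have "1 / (norm (t0 i - t0 j))\<^sup>2 \<le> c"
        unfolding c_def using ij
        by (intro member_le_sum[of "(i, j)" E "\<lambda>(i, j). 1 / (norm (t0 i - t0 j))\<^sup>2", simplified]) auto
      then have "1 \<le> c * (norm (t0 i - t0 j))\<^sup>2" using n by (simp add: field_simps)
      then show "1 \<le> trace (edge_constraint_matrix i j ** T0)"
        using edge[OF ij]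
        by (simp add: edge_constraint_matrix_gram trT0 transpose_edge_column_mult v)
    qed
    show "trace (centering_matrix ** T0) = 0"
      by (simp add: centering_matrix_gram trT0 transpose_block_column_mult v sum_subtractf \<mu>_def
          sum_constant_scaleR del: sum_constant)
    show "pos_semidef T0"
      using c_nonneg
      by (simp add: pos_semidef_def T0_def transpose_scalar transpose_outer_product
          scaleR_matrix_vector_assoc[symmetric] outer_product_mult_vector inner_commute mult.assoc)
  qed
  \<comment> \<open>Edge differences of \<open>v\<close> are those of \<open>t0\<close>, which the
    complementary projections annihilate.\<close>
  moreover have "trace (L0 ** T0) = 0"
    by (auto simp: trL trT0 A_def transpose_projected_edge_column_mult v line_projection_mult
        power2_norm_eq_inner intro!: sum.neutral)
  ultimately have "trace (L0 ** T) \<le> 0"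
    using assms(8) by (auto simp: sdp_solution_def is_arg_min_def not_less)
  then have "(\<Sum>(i, j)\<in>E. trace (A i j ** transpose (A i j) ** T)) = 0"
    using trace_gram_nonneg[OF psd] by (intro antisym sum_nonneg) (auto simp: trL)
  then have trA: "trace (A i j ** transpose (A i j) ** T) = 0" if "(i, j) \<in> E" for i j
    using trace_gram_nonneg[OF psd] that
    by (subst (asm) sum_nonneg_eq_0_iff) auto

  have range: "T *v x \<in> span {v}" for x
  proof -
    let ?y = "T *v x"
    let ?q = "vector_block ?y"
    \<comment> \<open>The difference equals its projection onto the line of
      \<open>t0 i - t0 j\<close>.\<close>
    have "\<exists>c. ?q i - ?q j = c *\<^sub>R (t0 i - t0 j)" if "(i, j) \<in> E" for i j
      using trace_gram_eq_0[OF psd trA[OF that], of x]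
      unfolding A_def transpose_projected_edge_column_mult line_projection_mult Let_def right_minus_eq
      by blast
    from parallel_rigid_kernel[OF assms(6) inj this]
    obtain a z where az: "\<And>k. ?q k = a *\<^sub>R t0 k + z" by blast
    \<comment> \<open>The centering constraint makes the blocks sum to 0, which fixes the
      translation \<open>z\<close>.\<close>
    have "trace (block_column (\<lambda>_. 1) ** transpose (block_column (\<lambda>_. 1)) ** T) = 0"
      using feasible by (simp add: sdp_feasible_def centering_matrix_gram)
    from trace_gram_eq_0[OF psd this, of x] have "(\<Sum>k\<in>UNIV. ?q k) = 0"
      by (simp add: transpose_block_column_mult)
    then have "a *\<^sub>R (\<Sum>k\<in>UNIV. t0 k) + real CARD('n) *\<^sub>R z = 0"
      by (simp add: az sum.distrib scaleR_sum_right sum_constant_scaleR del: sum_constant)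
    then have "(1 / real CARD('n)) *\<^sub>R (a *\<^sub>R (\<Sum>k\<in>UNIV. t0 k) + real CARD('n) *\<^sub>R z) = 0"
      by simp
    then have "a *\<^sub>R \<mu> + z = 0" by (simp add: \<mu>_def scaleR_add_right)
    then have z: "z = - (a *\<^sub>R \<mu>)" by (simp add: add_eq_0_iff)
    have "?q k = a *\<^sub>R vector_block v k" for k
      by (simp add: az z v algebra_simps)
    then have "?y = a *\<^sub>R v" by (auto simp: vec_eq_iff vector_block_def)
    then show ?thesis by (auto simp: span_singleton)
  qed
  have "T \<noteq> 0"
  proof
    assume "T = 0"
    moreover obtain i j where "(i, j) \<in> E"
      using parallel_rigid_nonempty[OF assms(6) inj assms(1,2)] by auto
    \<comment> \<open>At \<open>T = 0\<close> an edge constraint would read 1 \<le> 0.\<close>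
    ultimately show False using feasible by (auto simp: sdp_feasible_def trace_def)
  qed
  from leading_eigenvector_in_line[OF psd this range assms(9)]
  obtain b where "b \<noteq> 0" "t_hat = b *\<^sub>R v" by blast
  then have "vector_block t_hat k = b *\<^sub>R vector_block v k" for k
    by (simp add: vector_block_def vec_eq_iff)
  then have "vector_block t_hat k = b *\<^sub>R t0 k + (- b *\<^sub>R \<mu>)" for k
    by (simp add: v algebra_simps)
  with \<open>b \<noteq> 0\<close> show ?thesis unfolding congruent_points_def by blast
qed

end
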